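(* Let $A_0,B_0,C_0,D_0$ be four points, not all equal, of the unit sphere $\mathcal{S}\subset\mathbb{R}^3$ with center $O$, or four points, not all equal, of a planar circle $\mathcal{C}$ of center $O$ and radius $1$, and let $\mathcal{T}_0=(A_0B_0C_0D_0)$ be the corresponding tetrahedron or cyclic quadrilateral. Let $G_0$ be the centroid of $\mathcal{T}_0$, let $\mathcal{T}_1$ be the image of $\mathcal{T}_0$ under the construction described in the context, and let $G_1$ be the centroid of $\mathcal{T}_1$. Let $d_{ij}$ and $d_{ij}^1$ ($1\le i<j\le 4$) be the squared edge lengths of $\mathcal{T}_0$ and $\mathcal{T}_1$ respectively. Then the following inequalities hold: i) $OG_1\le OG_0$; ii) for any $(ijkl)\in\{(1234),(1324),(1423)\}$, $d_{ij}d_{kl}\le d_{ij}^1d_{kl}^1$; iii) $Pt(\mathcal{T}_0)\le Pt(\mathcal{T}_1)$. Moreover, for i), ii) and iii), equality holds if and only if $\mathcal{P}(\mathcal{T}_0)$ holds.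
   Context: $MN$ denotes the Euclidean distance between points $M,N$. Construction: $\mathcal{T}_1=(A_1B_1C_1D_1)$, where $A_1$ is the second intersection point of the line $G_0A_0$ with $\mathcal{S}$ (respectively with $\mathcal{C}$), other than $A_0$, and similarly $B_1,C_1,D_1$ are obtained from the lines $G_0B_0,G_0C_0,G_0D_0$. Squared edge lengths of $\mathcal{T}=(ABCD)$ (diagonals included when $\mathcal{T}$ is a quadrilateral): $d_{12}=AB^2$, $d_{13}=AC^2$, $d_{14}=AD^2$, $d_{23}=BC^2$, $d_{24}=BD^2$, $d_{34}=CD^2$. $Pt(\mathcal{T})=-\det\begin{pmatrix}0&d_{12}&d_{13}&d_{14}\\ d_{12}&0&d_{23}&d_{24}\\ d_{13}&d_{23}&0&d_{34}\\ d_{14}&d_{24}&d_{34}&0\end{pmatrix}$. For a tetrahedron or a cyclic quadrilateral $\mathcal{T}$, $\mathcal{P}(\mathcal{T})$ is the property: $d_{12}=d_{34}$, $d_{13}=d_{24}$ and $d_{14}=d_{23}$, i.e. $\mathcal{T}$ is an isosceles tetrahedron (a non-planar tetrahedron whose opposite edges have equal lengths) or a planar rectangle.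
   Formalization: "Equality iff P(T0)" fails in degenerate cases; proved instead: equality in i) iff P(T0) or three of the points coincide; in ii), for each (ijkl), iff P(T0) or d_ij d_kl = 0; in iii) iff P(T0) or Pt(T0)=0 (e.g. any four concyclic points). *)

theory Defs
  imports "HOL-Analysis.Analysis"
begin

text \<open>
  The vertices \<open>A, B, C, D\<close> are indexed by the type \<open>4\<close>, whose elements are
  \<open>1, 2, 3\<close> and \<open>4 = 0\<close>. The ambient space is any \<open>'a\<close> of class \<open>euclidean_space\<close>, so that
  \<open>sphere O 1\<close> is the unit sphere if \<open>DIM('a) = 3\<close> and the unit circle if \<open>DIM('a) = 2\<close>.
\<close>

definition centroid :: "(4 \<Rightarrow> 'a::euclidean_space) \<Rightarrow> 'a" where
  "centroid T = (1/4) *\<^sub>R (\<Sum>i\<in>UNIV. T i)"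

definition sqd :: "(4 \<Rightarrow> 'a::euclidean_space) \<Rightarrow> 4 \<Rightarrow> 4 \<Rightarrow> real" where
  "sqd T i j = (dist (T i) (T j))\<^sup>2"

definition Pt :: "(4 \<Rightarrow> 'a::euclidean_space) \<Rightarrow> real" where
  "Pt T = - det ((\<chi> i j. sqd T i j) :: real^4^4)"

text \<open>
  Isosceles tetrahedra and planar rectangles. As the condition is on lengths only, it also holds
  for the degenerate rectangles with two coincident pairs of vertices.
\<close>

definition opposite_edges_eq :: "(4 \<Rightarrow> 'a::euclidean_space) \<Rightarrow> bool" where
  "opposite_edges_eq T \<longleftrightarrow>
     sqd T 1 2 = sqd T 3 4 \<and> sqd T 1 3 = sqd T 2 4 \<and> sqd T 1 4 = sqd T 2 3"

text \<open>
  Degenerate quadruples \<open>(A, A, A, D)\<close>, up to order. The construction below swaps \<open>A\<close> and \<open>D\<close>, so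
  the centroid keeps its distance to the center although \<open>opposite_edges_eq\<close> fails.
\<close>

definition three_coincide :: "(4 \<Rightarrow> 'a) \<Rightarrow> bool" where
  "three_coincide T \<longleftrightarrow> (\<exists>i j k. distinct [i, j, k] \<and> T i = T j \<and> T j = T k)"

text \<open>
  The second intersection point, other than \<open>A\<close>, of the line \<open>GA\<close> with the unit sphere of center
  \<open>c\<close>. By \<open>ex1_second_point\<close> below it is well defined for \<open>A\<close> on the sphere and \<open>G\<close> in the open
  ball; by \<open>centroid_in_ball\<close> the latter holds for the centroid of points that are not all equal.
\<close>

definition second_point :: "'a::euclidean_space \<Rightarrow> 'a \<Rightarrow> 'a \<Rightarrow> 'a" where
  "second_point c G A = (THE X. X \<in> affine hull {G, A} \<inter> sphere c 1 \<and> X \<noteq> A)"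

definition second_quad :: "'a::euclidean_space \<Rightarrow> (4 \<Rightarrow> 'a) \<Rightarrow> (4 \<Rightarrow> 'a)" where
  "second_quad c T = (\<lambda>i. second_point c (centroid T) (T i))"

lemma ex1_second_point:
  fixes c G A :: "'a::euclidean_space"
  assumes A: "A \<in> sphere c 1" and G: "G \<in> ball c 1"
  shows "\<exists>!X. X \<in> affine hull {G, A} \<inter> sphere c 1 \<and> X \<noteq> A"
proof -
  define u where "u = A - G"
  define h where "h = G - c"
  have "A \<noteq> G" using A G by auto
  then have u: "u \<bullet> u > 0" by (simp add: u_def)
  have "(norm (u + h))\<^sup>2 = 1"
    using A by (simp add: u_def h_def dist_norm norm_minus_commute)
  then have s: "u \<bullet> u + 2 * (u \<bullet> h) + h \<bullet> h = 1"
    by (simp add: power2_norm_eq_inner inner_add_left inner_add_right inner_commute)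
  have "norm h < 1"
    using G by (simp add: h_def dist_norm norm_minus_commute)
  then have h: "h \<bullet> h < 1"
    by (metis norm_eq_sqrt_inner real_sqrt_lt_1_iff)
  define t0 where "t0 = (h \<bullet> h - 1) / (u \<bullet> u)"
  have on_sphere: "G + t *\<^sub>R u \<in> sphere c 1 \<longleftrightarrow> t = 1 \<or> t = t0" for t
  proof -
    have "G + t *\<^sub>R u \<in> sphere c 1 \<longleftrightarrow> (norm (t *\<^sub>R u + h))\<^sup>2 = 1"
    proof -
      have "dist c (G + t *\<^sub>R u) = norm (t *\<^sub>R u + h)"
        by (simp add: h_def dist_norm norm_minus_commute algebra_simps)
      then show ?thesis by (simp add: power2_eq_1_iff) (smt (verit) norm_ge_zero)
    qed
    also have "\<dots> \<longleftrightarrow> t * t * (u \<bullet> u) + 2 * t * (u \<bullet> h) + h \<bullet> h = 1"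
      by (simp add: power2_norm_eq_inner inner_add_left inner_add_right inner_commute algebra_simps)
    also have "\<dots> \<longleftrightarrow> (t - 1) * (t * (u \<bullet> u) - (h \<bullet> h - 1)) = 0"
    proof -
      have "t * t * (u \<bullet> u) + 2 * t * (u \<bullet> h) + h \<bullet> h - 1
            = (t - 1) * (t * (u \<bullet> u) - (h \<bullet> h - 1))"
        using s by algebra
      then show ?thesis by (metis eq_iff_diff_eq_0)
    qed
    also have "\<dots> \<longleftrightarrow> t = 1 \<or> t = t0"
      using u by (simp add: t0_def eq_divide_eq)
    finally show ?thesis .
  qed
  have line: "X \<in> affine hull {G, A} \<longleftrightarrow> (\<exists>t. X = G + t *\<^sub>R u)" for X
    by (auto simp: affine_hull_2_alt u_def)
  have inj: "G + t *\<^sub>R u = A \<longleftrightarrow> t = 1" for t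
  proof -
    have "G + t *\<^sub>R u = A \<longleftrightarrow> (t - 1) *\<^sub>R u = 0"
      by (simp add: u_def algebra_simps)
    then show ?thesis using u by auto
  qed
  have "t0 < 0" using h u by (simp add: t0_def divide_neg_pos)
  then have "t0 \<noteq> 1" by simp
  show ?thesis
  proof (rule ex1I[of _ "G + t0 *\<^sub>R u"])
    show "G + t0 *\<^sub>R u \<in> affine hull {G, A} \<inter> sphere c 1 \<and> G + t0 *\<^sub>R u \<noteq> A"
      using line on_sphere inj \<open>t0 \<noteq> 1\<close> by blast
  next
    fix X assume X: "X \<in> affine hull {G, A} \<inter> sphere c 1 \<and> X \<noteq> A"
    then obtain t where t: "X = G + t *\<^sub>R u" using line by blast
    then show "X = G + t0 *\<^sub>R u" using X on_sphere[of t] inj[of t] by simp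
  qed
qed

lemma centroid_in_ball:
  fixes T :: "4 \<Rightarrow> 'a::euclidean_space"
  assumes T: "\<And>i. T i \<in> sphere c 1" and ne: "T i \<noteq> T j"
  shows "centroid T \<in> ball c 1"
proof -
  define G where "G = centroid T"
  have G: "(\<Sum>i\<in>UNIV. T i) = 4 *\<^sub>R G" by (simp add: G_def centroid_def)
  have "(\<Sum>i\<in>UNIV. (T i - G)) = 0"
    using G by (simp add: sum_subtractf sum_constant_scaleR)
  then have z: "(\<Sum>i\<in>UNIV. (T i - G) \<bullet> (G - c)) = 0"
    by (metis inner_sum_left inner_zero_left)
  have "(T i - G) \<bullet> (T i - G) + 2 * ((T i - G) \<bullet> (G - c)) = 1 - (dist c G)\<^sup>2" for i
  proof -
    have "(norm ((T i - G) + (G - c)))\<^sup>2 = 1"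
      using T[of i] by (simp add: dist_norm norm_minus_commute)
    then show ?thesis
      by (simp add: power2_norm_eq_inner inner_add_left inner_add_right inner_commute
          dist_norm norm_minus_commute[of c] del: diff_add_cancel add_diff_cancel)
         (simp add: algebra_simps inner_commute)
  qed
  then have "(\<Sum>i\<in>(UNIV::4 set). (T i - G) \<bullet> (T i - G) + 2 * ((T i - G) \<bullet> (G - c)))
             = 4 * (1 - (dist c G)\<^sup>2)"
    by simp
  then have eq: "(\<Sum>i\<in>UNIV. (T i - G) \<bullet> (T i - G)) = 4 * (1 - (dist c G)\<^sup>2)"
    using z by (simp add: sum.distrib flip: sum_distrib_left)
  obtain k where "T k \<noteq> G" using ne by metis
  then have "(\<Sum>i\<in>UNIV. (T i - G) \<bullet> (T i - G)) > 0"
    by (intro sum_pos2[of _ k]) auto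
  then have "(dist c G)\<^sup>2 < 1" using eq by simp
  then show ?thesis
    by (simp add: G_def power2_less_1_iff)
qed

end

theory Submission
  imports Defs
begin

text \<open>
  Put the centroid \<open>G\<close> at the origin: let \<open>a\<^sub>i = T i - G\<close>, \<open>u\<^sub>i = \<bar>a\<^sub>i\<bar>\<^sup>2\<close> and \<open>h = G - c\<close>. Then \<open>\<Sum> a\<^sub>i = 0\<close>,
  and the power of \<open>G\<close> with respect to the sphere is \<open>- p\<close> with \<open>p = 1 - \<bar>h\<bar>\<^sup>2 > 0\<close>. That \<open>T i\<close> lies on
  the sphere says \<open>u\<^sub>i + 2 (a\<^sub>i \<bullet> h) = p\<close>, so the \<open>u\<^sub>i\<close> have the arithmetic mean \<open>p\<close>. They are all equal
  to \<open>p\<close> exactly if opposite edges of \<open>T\<close> are equal (\<open>opposite_edges_eq_iff\<close>). The second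
  intersection points are \<open>G - p a\<^sub>i / u\<^sub>i\<close>: the construction is an inversion centered at \<open>G\<close>, followed
  by the reflection in \<open>G\<close>.

  Products of opposite edges. An inversion multiplies the squared distance between the images of
  \<open>a\<^sub>i\<close> and \<open>a\<^sub>j\<close> by \<open>p\<^sup>2 / (u\<^sub>i u\<^sub>j)\<close>. Hence the construction multiplies each product \<open>d\<^sub>i\<^sub>j d\<^sub>k\<^sub>l\<close> of
  opposite edges by the same factor \<open>p\<^sup>4 / (u\<^sub>1 u\<^sub>2 u\<^sub>3 u\<^sub>4)\<close>, called \<open>ratio\<close> below. By the inequality of
  arithmetic and geometric means it is at least 1, with equality only if all \<open>u\<^sub>i\<close> are \<open>p\<close>.

  The function \<open>Pt\<close> is a quadratic form in the three products of opposite edges, so it is multiplied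
  by the square of \<open>ratio\<close>. By Ptolemy's inequality the square roots of the three products are the
  sides of a triangle, and Heron's formula then shows that \<open>Pt\<close> is nonnegative.

  Distance to the center. Let \<open>w\<^sub>i\<close> be the orthogonal projection of \<open>h\<close> to the line spanned by \<open>a\<^sub>i\<close>.
  Substituting \<open>p = u\<^sub>i + 2 (a\<^sub>i \<bullet> h)\<close> into \<open>G - p a\<^sub>i / u\<^sub>i\<close> gives \<open>G - a\<^sub>i - 2 w\<^sub>i\<close>, and so
  \<open>G\<^sub>1 - c = h - (1/2) \<Sum> w\<^sub>i\<close>. As \<open>h \<bullet> w\<^sub>i = \<bar>w\<^sub>i\<bar>\<^sup>2\<close>, expanding the square shows that the construction
  lowers \<open>\<bar>h\<bar>\<^sup>2\<close> by exactly the sum of the squared deviations of the \<open>w\<^sub>i\<close> from their mean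
  (\<open>dist_centroid_second_quad\<close>). Equality thus means that all \<open>w\<^sub>i\<close> coincide. Either they vanish,
  and then all \<open>u\<^sub>i\<close> are \<open>p\<close>, or all \<open>a\<^sub>i\<close> are parallel to one vector, and the four points are among
  the two intersection points of a line with the sphere (\<open>w_const_iff\<close>).
\<close>

section \<open>Means\<close>

text \<open>
  The inequality of arithmetic and geometric means, normalized to mean 1: it is the sum of the
  inequalities \<open>ln (x i) \<le> x i - 1\<close>, each of which is strict unless \<open>x i = 1\<close>.
\<close>

lemma prod_le_one_if_sum_eq_card:
  fixes x :: "'i \<Rightarrow> real"
  assumes fin: "finite I" and pos: "\<And>i. i \<in> I \<Longrightarrow> x i > 0" and sum: "(\<Sum>i\<in>I. x i) = card I"
  shows "(\<Prod>i\<in>I. x i) \<le> 1" and "(\<Prod>i\<in>I. x i) = 1 \<longleftrightarrow> (\<forall>i\<in>I. x i = 1)"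
proof -
  have ln_prod_x: "ln (\<Prod>i\<in>I. x i) = (\<Sum>i\<in>I. ln (x i))"
    using fin pos by (simp add: ln_prod less_imp_neq[symmetric])
  have prod_pos: "(\<Prod>i\<in>I. x i) > 0"
    using pos by (intro prod_pos) auto
  have gap: "(\<Sum>i\<in>I. x i - 1 - ln (x i)) = - ln (\<Prod>i\<in>I. x i)"
    using sum by (simp add: ln_prod_x sum_subtractf)
  have nonneg: "x i - 1 - ln (x i) \<ge> 0" if "i \<in> I" for i
    using ln_le_minus_one[OF pos[OF that]] by simp
  have "ln (\<Prod>i\<in>I. x i) \<le> 0"
    using sum_nonneg[of I "\<lambda>i. x i - 1 - ln (x i)"] nonneg gap by simp
  then show "(\<Prod>i\<in>I. x i) \<le> 1"
    using prod_pos by simp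
  show "(\<Prod>i\<in>I. x i) = 1 \<longleftrightarrow> (\<forall>i\<in>I. x i = 1)"
  proof
    assume "(\<Prod>i\<in>I. x i) = 1"
    then have "(\<Sum>i\<in>I. x i - 1 - ln (x i)) = 0"
      using gap by simp
    then have "\<forall>i\<in>I. x i - 1 - ln (x i) = 0"
      using fin nonneg by (subst (asm) sum_nonneg_eq_0_iff) auto
    then show "\<forall>i\<in>I. x i = 1"
      using pos ln_eq_minus_one by fastforce
  qed auto
qed

lemma sum_norm_diff_mean_sq:
  fixes f :: "'i \<Rightarrow> 'a::real_inner"
  assumes "finite I" "I \<noteq> {}"
  defines "m \<equiv> (1 / card I) *\<^sub>R (\<Sum>i\<in>I. f i)"
  shows "(\<Sum>i\<in>I. (norm (f i - m))\<^sup>2)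
         = (\<Sum>i\<in>I. (norm (f i))\<^sup>2) - (norm (\<Sum>i\<in>I. f i))\<^sup>2 / card I"
proof -
  define s where "s = (\<Sum>i\<in>I. f i)"
  have n: "real (card I) \<noteq> 0"
    using assms by simp
  have "(\<Sum>i\<in>I. (norm (f i - m))\<^sup>2) = (\<Sum>i\<in>I. (norm (f i))\<^sup>2 - 2 * (f i \<bullet> m) + m \<bullet> m)"
    by (rule sum.cong) (simp_all add: power2_norm_eq_inner inner_diff inner_commute)
  also have "\<dots> = (\<Sum>i\<in>I. (norm (f i))\<^sup>2) - 2 * (s \<bullet> m) + card I * (m \<bullet> m)"
    by (simp add: sum.distrib sum_subtractf s_def inner_sum_left flip: sum_distrib_left)
  also have "\<dots> = (\<Sum>i\<in>I. (norm (f i))\<^sup>2) - (norm s)\<^sup>2 / card I"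
    using n by (simp add: m_def power2_norm_eq_inner field_simps flip: s_def)
  finally show ?thesis
    by (simp add: s_def)
qed

section \<open>Inversion and Ptolemy's inequality\<close>

lemma norm_inversion_diff:
  fixes x y :: "'a::real_inner"
  assumes "x \<noteq> 0" "y \<noteq> 0"
  shows "norm (x /\<^sub>R (norm x)\<^sup>2 - y /\<^sub>R (norm y)\<^sup>2) = norm (x - y) / (norm x * norm y)"
proof -
  have "(norm (x /\<^sub>R (norm x)\<^sup>2 - y /\<^sub>R (norm y)\<^sup>2))\<^sup>2 = (norm (x - y) / (norm x * norm y))\<^sup>2"
  proof -
    have "x \<bullet> x \<noteq> 0" "y \<bullet> y \<noteq> 0"
      using assms by auto
    then show ?thesis
      unfolding power_divide power_mult_distrib power2_norm_eq_inner
      by (simp add: inner_diff inner_commute field_simps)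
  qed
  then show ?thesis
    by (rule power2_eq_imp_eq) simp_all
qed

text \<open>
  Ptolemy's inequality with the fourth point at the origin is the triangle inequality for the images
  of the other three under the inversion.
\<close>

lemma ptolemy_inequality_norm:
  fixes x y z :: "'a::real_inner"
  shows "norm (x - y) * norm z \<le> norm (x - z) * norm y + norm (y - z) * norm x"
proof (cases "x = 0 \<or> y = 0 \<or> z = 0")
  case True
  then show ?thesis
    by (auto simp: mult.commute)
next
  case False
  define i where "i v = v /\<^sub>R (norm v)\<^sup>2" for v :: 'a
  have "norm (i x - i y) \<le> norm (i x - i z) + norm (i y - i z)"
    using norm_triangle_ineq4[of "i x - i z" "i y - i z"] by simp
  then have "norm (x - y) / (norm x * norm y)
      \<le> norm (x - z) / (norm x * norm z) + norm (y - z) / (norm y * norm z)"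
    using False by (simp add: i_def norm_inversion_diff)
  then show ?thesis
    using False by (simp add: field_simps)
qed

lemma ptolemy_inequality:
  fixes A B C D :: "'a::real_inner"
  shows "dist A B * dist C D \<le> dist A C * dist B D + dist A D * dist B C"
  using ptolemy_inequality_norm[of "A - D" "B - D" "C - D"] by (simp add: dist_norm mult.commute)

section \<open>The function \<open>Pt\<close>\<close>

lemma det_4:
  fixes M :: "'a::comm_ring_1^4^4"
  shows "det M =
     M$1$1 * (M$2$2 * (M$3$3 * M$4$4 - M$3$4 * M$4$3) - M$2$3 * (M$3$2 * M$4$4 - M$3$4 * M$4$2)
              + M$2$4 * (M$3$2 * M$4$3 - M$3$3 * M$4$2))
   - M$1$2 * (M$2$1 * (M$3$3 * M$4$4 - M$3$4 * M$4$3) - M$2$3 * (M$3$1 * M$4$4 - M$3$4 * M$4$1)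
              + M$2$4 * (M$3$1 * M$4$3 - M$3$3 * M$4$1))
   + M$1$3 * (M$2$1 * (M$3$2 * M$4$4 - M$3$4 * M$4$2) - M$2$2 * (M$3$1 * M$4$4 - M$3$4 * M$4$1)
              + M$2$4 * (M$3$1 * M$4$2 - M$3$2 * M$4$1))
   - M$1$4 * (M$2$1 * (M$3$2 * M$4$3 - M$3$3 * M$4$2) - M$2$2 * (M$3$1 * M$4$3 - M$3$3 * M$4$1)
              + M$2$3 * (M$3$1 * M$4$2 - M$3$2 * M$4$1))"
proof -
  have f234: "finite {2::4, 3, 4}" "1 \<notin> {2::4, 3, 4}"
    by auto
  have f34: "finite {3::4, 4}" "2 \<notin> {3::4, 4}"
    by auto
  have f4: "finite {4::4}" "3 \<notin> {4::4}"
    by auto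
  show ?thesis
    unfolding det_def UNIV_4
    unfolding sum_over_permutations_insert[OF f234]
    unfolding sum_over_permutations_insert[OF f34]
    unfolding sum_over_permutations_insert[OF f4]
    unfolding permutes_sing
    by (simp add: sign_swap_id permutation_swap_id permutation_compose sign_compose sign_id swap_id_eq algebra_simps)
qed

lemma sqd_self [simp]: "sqd T i i = 0"
  by (simp add: sqd_def)

lemma sqd_commute: "sqd T i j = sqd T j i"
  by (simp add: sqd_def dist_commute)

lemma Pt_eq:
  fixes T :: "4 \<Rightarrow> 'a::euclidean_space"
  defines "x \<equiv> sqd T 1 2 * sqd T 3 4" and "y \<equiv> sqd T 1 3 * sqd T 2 4"
    and "z \<equiv> sqd T 1 4 * sqd T 2 3"
  shows "Pt T = 2 * x * y + 2 * y * z + 2 * z * x - x\<^sup>2 - y\<^sup>2 - z\<^sup>2"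
  unfolding Pt_def det_4 x_def y_def z_def
  by (simp add: sqd_commute[of T 2 1] sqd_commute[of T 3 1] sqd_commute[of T 4 1]
      sqd_commute[of T 3 2] sqd_commute[of T 4 2] sqd_commute[of T 4 3]
      power2_eq_square algebra_simps)

text \<open>
  In terms of the square roots \<open>r, s, t\<close> of the products of opposite edges, \<open>Pt\<close> is the product that
  occurs in Heron's formula, and Ptolemy's inequality says that \<open>r, s, t\<close> are the sides of a
  (possibly degenerate) triangle.
\<close>

lemma Pt_nonneg: "Pt T \<ge> 0"
proof -
  define r s t where "r = dist (T 1) (T 2) * dist (T 3) (T 4)"
    and "s = dist (T 1) (T 3) * dist (T 2) (T 4)"
    and "t = dist (T 1) (T 4) * dist (T 2) (T 3)"
  have "r \<le> s + t" "s \<le> r + t" "t \<le> r + s"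
    using ptolemy_inequality[of "T 1" "T 2" "T 3" "T 4"]
      ptolemy_inequality[of "T 1" "T 3" "T 2" "T 4"]
      ptolemy_inequality[of "T 1" "T 4" "T 2" "T 3"]
    by (simp_all add: r_def s_def t_def dist_commute)
  moreover have "r \<ge> 0" "s \<ge> 0" "t \<ge> 0"
    by (simp_all add: r_def s_def t_def)
  ultimately have "0 \<le> (r + s + t) * (s + t - r) * (r + t - s) * (r + s - t)"
    by simp
  also have "\<dots> = Pt T"
    unfolding Pt_eq sqd_def r_def s_def t_def power_mult_distrib[symmetric]
    by (simp add: power2_eq_square algebra_simps)
  finally show ?thesis .
qed

section \<open>Four points of the unit sphere\<close>

text \<open>
  The two intersection points lie on opposite sides of \<open>G\<close>, and the product of their distances to
  \<open>G\<close> is minus the power of \<open>G\<close> with respect to the sphere.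
\<close>

lemma second_point_eq:
  fixes c G A :: "'a::euclidean_space"
  assumes A: "A \<in> sphere c 1" and G: "G \<in> ball c 1"
  shows "second_point c G A = G - ((1 - (dist c G)\<^sup>2) / (norm (A - G))\<^sup>2) *\<^sub>R (A - G)"
proof -
  define u h where "u = A - G" and "h = G - c"
  define p where "p = 1 - h \<bullet> h"
  define X where "X = G - (p / (u \<bullet> u)) *\<^sub>R u"
  have p_eq: "p = 1 - (dist c G)\<^sup>2"
    by (simp add: p_def h_def dist_norm norm_minus_commute power2_norm_eq_inner)
  have u: "u \<noteq> 0"
    using A G by (auto simp: u_def)
  have "p > 0"
    using G by (simp add: p_eq abs_square_less_1)
  have "(norm (u + h))\<^sup>2 = 1"
    using A by (simp add: u_def h_def dist_norm norm_minus_commute)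
  then have power: "u \<bullet> u + 2 * (u \<bullet> h) = p"
    by (simp add: power2_norm_eq_inner inner_add inner_commute p_def)
  have p_minus: "p - 2 * (u \<bullet> h) = u \<bullet> u"
    using power by simp
  have "(norm (X - c))\<^sup>2 = (norm (h - (p / (u \<bullet> u)) *\<^sub>R u))\<^sup>2"
    by (simp add: X_def h_def algebra_simps)
  also have "\<dots> = h \<bullet> h - 2 * (p / (u \<bullet> u)) * (u \<bullet> h) + (p / (u \<bullet> u))\<^sup>2 * (u \<bullet> u)"
    by (simp only: power2_norm_eq_inner)
       (simp add: inner_diff inner_commute power2_eq_square)
  also have "\<dots> = h \<bullet> h + (p / (u \<bullet> u)) * (p - 2 * (u \<bullet> h))"
    using u by (simp add: power2_eq_square field_simps)
  also have "\<dots> = 1"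
    using u p_minus by (simp add: p_def)
  finally have "X \<in> sphere c 1"
    by (simp add: dist_norm norm_minus_commute power2_eq_1_iff) (smt (verit) norm_ge_zero)
  moreover have "X \<in> affine hull {G, A}"
    unfolding affine_hull_2_alt
    by (auto simp: X_def u_def intro!: image_eqI[of _ _ "- (p / ((A - G) \<bullet> (A - G)))"])
  moreover have "X \<noteq> A"
  proof
    assume "X = A"
    then have "(1 + p / (u \<bullet> u)) *\<^sub>R u = 0"
      by (simp add: X_def u_def algebra_simps)
    moreover have "p / (u \<bullet> u) > 0"
      using \<open>p > 0\<close> u by simp
    ultimately show False
      using u by simp
  qed
  ultimately have "second_point c G A = X"
    unfolding second_point_def using ex1_second_point[OF A G] by (intro the1_equality) auto
  then show ?thesis
    by (simp add: X_def p_eq u_def power2_norm_eq_inner)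
qed

locale spherical_quad =
  fixes c :: "'a::euclidean_space" and T :: "4 \<Rightarrow> 'a"
  assumes on_sphere: "T i \<in> sphere c 1"
    and not_all_equal: "\<exists>i j. T i \<noteq> T j"
begin

definition h :: 'a where "h = centroid T - c"

definition a :: "4 \<Rightarrow> 'a" where "a i = T i - centroid T"

text \<open>Minus the power of the centroid with respect to the sphere.\<close>

definition p :: real where "p = 1 - (dist c (centroid T))\<^sup>2"

abbreviation u :: "4 \<Rightarrow> real" where "u i \<equiv> (norm (a i))\<^sup>2"

text \<open>The orthogonal projection of \<open>h\<close> to the line spanned by \<open>a i\<close>.\<close>

definition w :: "4 \<Rightarrow> 'a" where "w i = ((a i \<bullet> h) / u i) *\<^sub>R a i"

lemma centroid_in_unit_ball: "centroid T \<in> ball c 1"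
  using not_all_equal centroid_in_ball[of T] on_sphere by blast

lemma p_pos: "p > 0"
  using centroid_in_unit_ball by (simp add: p_def abs_square_less_1)

lemma a_nonzero: "a i \<noteq> 0"
  using on_sphere[of i] centroid_in_unit_ball by (auto simp: a_def)

lemma u_pos: "u i > 0"
  using a_nonzero by simp

lemma sum_a: "a 1 + a 2 + a 3 + a 4 = 0"
proof -
  have "T 1 + T 2 + T 3 + T 4 = 4 *\<^sub>R centroid T"
    by (simp add: centroid_def sum_4)
  also have "\<dots> = 2 *\<^sub>R (2 *\<^sub>R centroid T)"
    by simp
  finally show ?thesis
    unfolding scaleR_2 by (simp add: a_def algebra_simps)
qed

text \<open>This is the equation \<open>\<bar>a i + h\<bar>\<^sup>2 = 1\<close> of the sphere, expanded.\<close>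

lemma power_of_centroid: "u i + 2 * (a i \<bullet> h) = p"
proof -
  have "(norm (a i + h))\<^sup>2 = 1"
    using on_sphere[of i] by (simp add: a_def h_def dist_norm norm_minus_commute)
  moreover have "p = 1 - (norm h)\<^sup>2"
    by (simp add: p_def h_def dist_norm norm_minus_commute)
  ultimately show ?thesis
    by (simp add: power2_norm_eq_inner inner_add inner_commute)
qed

lemma sum_u: "(\<Sum>i\<in>UNIV. u i) = 4 * p"
proof -
  have "(a 1 + a 2 + a 3 + a 4) \<bullet> h = 0"
    by (simp add: sum_a)
  then show ?thesis
    using power_of_centroid[of 1] power_of_centroid[of 2] power_of_centroid[of 3]
      power_of_centroid[of 4]
    by (simp add: sum_4 inner_add_left)
qed

lemma second_quad_eq: "second_quad c T i = centroid T - p *\<^sub>R (a i /\<^sub>R u i)"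
  unfolding second_quad_def second_point_eq[OF on_sphere centroid_in_unit_ball]
  by (simp add: p_def a_def divide_inverse)

lemma sqd_second_quad: "sqd (second_quad c T) i j = p\<^sup>2 * sqd T i j / (u i * u j)"
proof -
  have "sqd (second_quad c T) i j = (norm (p *\<^sub>R (a i /\<^sub>R u i - a j /\<^sub>R u j)))\<^sup>2"
    unfolding sqd_def second_quad_eq dist_norm
    by (simp add: scaleR_diff_right norm_minus_commute)
  also have "\<dots> = p\<^sup>2 * (norm (a i - a j) / (norm (a i) * norm (a j)))\<^sup>2"
    unfolding norm_scaleR norm_inversion_diff[OF a_nonzero a_nonzero]
    by (simp only: power_mult_distrib power2_abs)
  also have "a i - a j = T i - T j"
    by (simp add: a_def)
  finally show ?thesis
    by (simp add: sqd_def dist_norm power_divide power_mult_distrib)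
qed

text \<open>
  If the \<open>a i\<close> have equal length, the parallelogram law turns \<open>a 1 + a 2 = - (a 3 + a 4)\<close> into the
  equality of the opposite edges 12 and 34. Conversely, as the \<open>a i\<close> add up to zero, the sum of the
  three squared edges at the vertex \<open>i\<close> is \<open>4 u i + 4 p\<close>; if opposite edges are equal, each vertex
  meets one edge of each length, and these sums agree.
\<close>

lemma opposite_edges_eq_iff: "opposite_edges_eq T \<longleftrightarrow> (\<forall>i. u i = p)"
proof
  assume u_eq: "\<forall>i. u i = p"
  have "norm (a i - a j) = norm (a k - a l)" if "a i + a j = - (a k + a l)" for i j k l
  proof -
    have "(norm (a i - a j))\<^sup>2 = 4 * p - (norm (a i + a j))\<^sup>2" for i j
      using u_eq[rule_format, of i] u_eq[rule_format, of j]
      by (simp add: power2_norm_eq_inner inner_diff inner_add inner_commute)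
    then have "(norm (a i - a j))\<^sup>2 = (norm (a k - a l))\<^sup>2"
      using that by (metis norm_minus_cancel)
    then show ?thesis
      by simp
  qed
  moreover have "a 1 + a 2 = - (a 3 + a 4)" "a 1 + a 3 = - (a 2 + a 4)" "a 1 + a 4 = - (a 2 + a 3)"
    unfolding eq_neg_iff_add_eq_0 using sum_a by (simp_all add: ac_simps)
  ultimately show "opposite_edges_eq T"
    by (simp add: opposite_edges_eq_def sqd_def dist_norm a_def)
next
  assume opp: "opposite_edges_eq T"
  have edges: "(\<Sum>j\<in>UNIV. sqd T i j) = 4 * u i + 4 * p" for i
  proof -
    have "sqd T i j = u i + u j - 2 * (a i \<bullet> a j)" for j
      by (simp add: sqd_def dist_norm a_def power2_norm_eq_inner inner_diff inner_commute)
    moreover have "a i \<bullet> (a 1 + a 2 + a 3 + a 4) = 0"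
      by (simp add: sum_a)
    ultimately show ?thesis
      using sum_u by (simp add: sum_4 inner_add_right)
  qed
  then have "u 1 = u 2 \<and> u 1 = u 3 \<and> u 1 = u 4"
    using opp edges[of 1] edges[of 2] edges[of 3] edges[of 4]
    unfolding sum_4 opposite_edges_eq_def sqd_self
    by (smt (verit) sqd_commute)
  then show "\<forall>i. u i = p"
    using sum_u unfolding sum_4 forall_4 by linarith
qed

subsection \<open>Products of opposite edges\<close>

text \<open>The factor by which the construction multiplies the products of opposite squared edges.\<close>

definition ratio :: real where "ratio = p ^ 4 / (u 1 * u 2 * u 3 * u 4)"

lemma ratio_ge_1: "ratio \<ge> 1"
  and ratio_eq_1_iff: "ratio = 1 \<longleftrightarrow> opposite_edges_eq T"
proof -
  have prod: "(\<Prod>i\<in>UNIV. u i / p) = inverse ratio"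
  proof -
    have prod_4: "(\<Prod>i\<in>UNIV. f i) = f 1 * f 2 * f 3 * f 4" for f :: "4 \<Rightarrow> real"
      unfolding UNIV_4 by (simp add: mult.assoc)
    show ?thesis
      by (simp only: prod_4 ratio_def power4_eq_xxxx inverse_divide times_divide_times_eq)
  qed
  have sum: "(\<Sum>i\<in>UNIV. u i / p) = card (UNIV :: 4 set)"
    unfolding sum_divide_distrib[symmetric] sum_u using p_pos by simp
  have pos: "u i / p > 0" for i
    using u_pos p_pos by simp
  note mean_ineq = prod_le_one_if_sum_eq_card[where I = UNIV and x = "\<lambda>i. u i / p", OF finite pos sum]
  have "ratio > 0"
    using u_pos p_pos by (simp add: ratio_def)
  then show "ratio \<ge> 1"
    using mean_ineq(1) unfolding prod by (simp add: inverse_le_1_iff)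
  show "ratio = 1 \<longleftrightarrow> opposite_edges_eq T"
    using mean_ineq(2) p_pos unfolding prod by (simp add: opposite_edges_eq_iff) metis
qed

text \<open>
  The assumption holds if \<open>(i, j, k, l)\<close> is a permutation of the four vertices; in this form the
  simplifier can check it for each of the three pairs of opposite edges.
\<close>

lemma opposite_product_second_quad:
  assumes "u i * u j * (u k * u l) = u 1 * u 2 * u 3 * u 4"
  shows "sqd (second_quad c T) i j * sqd (second_quad c T) k l = ratio * (sqd T i j * sqd T k l)"
  unfolding sqd_second_quad ratio_def assms[symmetric]
  by (simp add: power4_eq_xxxx power2_eq_square)

lemma Pt_second_quad: "Pt (second_quad c T) = ratio\<^sup>2 * Pt T"
proof -
  have "sqd (second_quad c T) 1 2 * sqd (second_quad c T) 3 4 = ratio * (sqd T 1 2 * sqd T 3 4)"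
    "sqd (second_quad c T) 1 3 * sqd (second_quad c T) 2 4 = ratio * (sqd T 1 3 * sqd T 2 4)"
    "sqd (second_quad c T) 1 4 * sqd (second_quad c T) 2 3 = ratio * (sqd T 1 4 * sqd T 2 3)"
    by (simp_all add: opposite_product_second_quad)
  then show ?thesis
    unfolding Pt_eq by (simp add: power2_eq_square algebra_simps)
qed

subsection \<open>Distance from the center to the centroid\<close>

lemma h_inner_w: "h \<bullet> w i = (norm (w i))\<^sup>2"
  using u_pos[of i]
  by (simp add: w_def power_mult_distrib power_divide power2_eq_square inner_commute)

text \<open>
  With \<open>s = \<Sum> w i\<close> the squared norm of \<open>h - (1/2) s\<close> is \<open>\<bar>h\<bar>\<^sup>2 - \<Sum> \<bar>w i\<bar>\<^sup>2 + \<bar>s\<bar>\<^sup>2 / 4\<close>, and the last two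
  terms form minus the total squared deviation of the four vectors \<open>w i\<close> from their mean.
\<close>

lemma dist_centroid_second_quad:
  "(dist c (centroid (second_quad c T)))\<^sup>2
     = (dist c (centroid T))\<^sup>2 - (\<Sum>i\<in>UNIV. (norm (w i - (1/4) *\<^sub>R (\<Sum>j\<in>UNIV. w j)))\<^sup>2)"
proof -
  define s where "s = (\<Sum>i\<in>UNIV. w i)"
  have "second_quad c T i = centroid T - a i - 2 *\<^sub>R w i" for i
  proof -
    have "p *\<^sub>R (a i /\<^sub>R u i) = ((u i + 2 * (a i \<bullet> h)) / u i) *\<^sub>R a i"
      by (simp add: power_of_centroid divide_inverse)
    also have "\<dots> = a i + 2 *\<^sub>R w i"
      using a_nonzero[of i] by (simp add: w_def add_divide_distrib scaleR_add_left)
    finally show ?thesis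
      by (simp add: second_quad_eq)
  qed
  then have "(\<Sum>i\<in>UNIV. second_quad c T i) = 4 *\<^sub>R centroid T - (\<Sum>i\<in>UNIV. a i) - 2 *\<^sub>R s"
    by (simp add: sum_subtractf s_def scaleR_sum_right sum_constant_scaleR)
  then have "centroid (second_quad c T) - c = h - (1/2) *\<^sub>R s"
    by (simp add: centroid_def[of "second_quad c T"] h_def sum_4[of a] sum_a scaleR_diff_right)
  then have "(dist c (centroid (second_quad c T)))\<^sup>2 = (norm (h - (1/2) *\<^sub>R s))\<^sup>2"
    by (metis dist_commute dist_norm)
  also have "\<dots> = (norm h)\<^sup>2 - h \<bullet> s + (norm s)\<^sup>2 / 4"
    by (simp only: power2_norm_eq_inner) (simp add: inner_diff inner_commute)
  also have "h \<bullet> s = (\<Sum>i\<in>UNIV. (norm (w i))\<^sup>2)"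
    by (simp add: s_def inner_sum_right h_inner_w)
  also have "norm h = dist c (centroid T)"
    by (simp add: h_def dist_norm norm_minus_commute)
  finally show ?thesis
    using sum_norm_diff_mean_sq[of "UNIV :: 4 set" w] by (simp add: s_def)
qed

text \<open>
  Four vertices that take two values, told apart by \<open>P\<close>: if no three coincide, they coincide in two
  pairs and form a degenerate rectangle.
\<close>

lemma two_values_cases:
  fixes P :: "4 \<Rightarrow> bool"
  assumes "\<And>i j. P i = P j \<Longrightarrow> T i = T j"
  shows "opposite_edges_eq T \<or> three_coincide T"
proof (rule disjCI)
  assume no3: "\<not> three_coincide T"
  have "\<not> (P i = P j \<and> P j = P k)" if "distinct [i, j, k]" for i j k
    using no3 assms that unfolding three_coincide_def by blast
  from this[of 1 2 3] this[of 1 2 4] this[of 1 3 4] this[of 2 3 4]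
  have "(P 1 = P 2 \<and> P 3 = P 4) \<or> (P 1 = P 3 \<and> P 2 = P 4) \<or> (P 1 = P 4 \<and> P 2 = P 3)"
    by auto
  then have "(T 1 = T 2 \<and> T 3 = T 4) \<or> (T 1 = T 3 \<and> T 2 = T 4) \<or> (T 1 = T 4 \<and> T 2 = T 3)"
    using assms by blast
  then show "opposite_edges_eq T"
    by (auto simp: opposite_edges_eq_def sqd_def dist_commute)
qed

text \<open>
  If the common value \<open>m\<close> of the \<open>w i\<close> is not zero, then \<open>a i = s i *\<^sub>R m\<close>, and the equation of the
  sphere becomes a quadratic equation for \<open>s i\<close>. It has one positive and one negative root, so the
  sign of \<open>s i\<close> determines the vertex. Conversely, three coinciding vertices force the fourth
  \<open>a l\<close> to be \<open>-3\<close> times the others, and \<open>w\<close> depends only on the lines spanned by the \<open>a i\<close>.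
\<close>

lemma w_const_iff: "(\<exists>m. \<forall>i. w i = m) \<longleftrightarrow> opposite_edges_eq T \<or> three_coincide T"
proof
  assume "\<exists>m. \<forall>i. w i = m"
  then obtain m where m: "w i = m" for i
    by blast
  show "opposite_edges_eq T \<or> three_coincide T"
  proof (cases "m = 0")
    case True
    have "u i = p" for i
      using m[of i] True a_nonzero[of i] power_of_centroid[of i] by (auto simp: w_def)
    then show ?thesis
      by (simp add: opposite_edges_eq_iff)
  next
    case False
    define s where "s i = u i / (a i \<bullet> h)" for i
    define q where "q = (norm m)\<^sup>2"
    have q: "q > 0"
      using False by (simp add: q_def)
    have a_eq: "a i = s i *\<^sub>R m" for i
    proof -
      have "a i \<bullet> h \<noteq> 0"
        using m[of i] False by (auto simp: w_def)
      then show ?thesis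
        using u_pos[of i] by (simp add: s_def w_def flip: m[of i])
    qed
    have root: "(s i)\<^sup>2 * q + 2 * s i * q = p" for i
      using power_of_centroid[of i] h_inner_w[of i]
      unfolding m by (simp add: a_eq[of i] q_def power_mult_distrib inner_commute)
    show ?thesis
    proof (rule two_values_cases[of "\<lambda>i. s i > 0"])
      fix i j assume sign: "(s i > 0) = (s j > 0)"
      have "s i = s j"
      proof (rule ccontr)
        assume "s i \<noteq> s j"
        \<comment> \<open>Vieta: two distinct roots have the sum \<open>-2\<close> and the product \<open>- p / q\<close>.\<close>
        have "(s i - s j) * (s i + s j + 2) * q = 0"
          using root[of i] root[of j] by (simp add: power2_eq_square algebra_simps)
        then have sj: "s j = - 2 - s i"
          using \<open>s i \<noteq> s j\<close> q by simp
        have "s i * s j * q = - ((s i)\<^sup>2 * q + 2 * s i * q)"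
          by (simp add: sj power2_eq_square algebra_simps)
        then have "s i * s j * q = - p"
          by (simp only: root)
        then have "s i * s j < 0"
          using p_pos q by (metis neg_less_0_iff_less mult_less_0_iff less_asym)
        then show False
          using sign by (auto simp: mult_less_0_iff)
      qed
      then have "a i = a j"
        by (simp add: a_eq)
      then show "T i = T j"
        by (simp add: a_def)
    qed
  qed
next
  assume "opposite_edges_eq T \<or> three_coincide T"
  then show "\<exists>m. \<forall>i. w i = m"
  proof
    assume "opposite_edges_eq T"
    then have "a i \<bullet> h = 0" for i
      using power_of_centroid[of i] by (simp add: opposite_edges_eq_iff)
    then show ?thesis
      by (simp add: w_def)
  next
    assume "three_coincide T"
    then obtain i j k where ijk: "distinct [i, j, k]" "T i = T j" "T j = T k"
      unfolding three_coincide_def by blast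
    have "card (UNIV - {i, j, k}) = 1"
      using ijk(1) by (simp add: card_Diff_subset)
    then obtain l where l: "UNIV - {i, j, k} = {l}"
      by (auto simp: card_1_singleton_iff)
    have UNIV_ijkl: "UNIV = {i, j, k, l}" and "l \<notin> {i, j, k}"
      using l by blast+
    have aj: "a j = a i" "a k = a i"
      using ijk by (simp_all add: a_def)
    have "(\<Sum>n\<in>UNIV. a n) = 0"
      by (simp add: sum_4 sum_a)
    then have "a i + a i + a i + a l = 0"
      unfolding UNIV_ijkl using ijk(1) \<open>l \<notin> {i, j, k}\<close> by (auto simp: aj add.assoc)
    then have al: "a l = - (a i + a i + a i)"
      by (metis add_eq_0_iff)
    also have "\<dots> = (- 3) *\<^sub>R a i"
      by (metis scaleR_minus_left scaleR_2 scaleR_left_distrib scaleR_one numeral_Bit1 numeral_One one_add_one)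
    finally have "w l = w i"
      by (simp add: w_def power_mult_distrib)
    moreover have "w j = w i" "w k = w i"
      by (simp_all add: w_def aj)
    ultimately have "\<forall>n\<in>{i, j, k, l}. w n = w i"
      by simp
    then show ?thesis
      by (metis UNIV_I UNIV_ijkl)
  qed
qed

lemma dist_centroid_second_quad_le: "dist c (centroid (second_quad c T)) \<le> dist c (centroid T)"
proof -
  have "(dist c (centroid (second_quad c T)))\<^sup>2 \<le> (dist c (centroid T))\<^sup>2"
    unfolding dist_centroid_second_quad by (simp add: sum_nonneg)
  then show ?thesis
    by (rule power2_le_imp_le) simp
qed

lemma dist_centroid_second_quad_eq_iff:
  "dist c (centroid (second_quad c T)) = dist c (centroid T)
     \<longleftrightarrow> opposite_edges_eq T \<or> three_coincide T"
proof -
  define m where "m = (1/4) *\<^sub>R (\<Sum>j\<in>UNIV. w j)"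
  have "dist c (centroid (second_quad c T)) = dist c (centroid T)
      \<longleftrightarrow> (dist c (centroid (second_quad c T)))\<^sup>2 = (dist c (centroid T))\<^sup>2"
    by simp
  also have "\<dots> \<longleftrightarrow> (\<Sum>i\<in>UNIV. (norm (w i - m))\<^sup>2) = 0"
    unfolding dist_centroid_second_quad m_def by simp
  also have "\<dots> \<longleftrightarrow> (\<forall>i. w i = m)"
    by (subst sum_nonneg_eq_0_iff) auto
  also have "\<dots> \<longleftrightarrow> (\<exists>m. \<forall>i. w i = m)"
  proof -
    have "m = m'" if "\<forall>i. w i = m'" for m'
      using that by (simp add: m_def sum_constant_scaleR)
    then show ?thesis
      by blast
  qed
  finally show ?thesis
    unfolding w_const_iff .
qed

end

theorem theorem1:
  fixes ctr :: "'a::euclidean_space"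
    and T0 T1 :: "4 \<Rightarrow> 'a"
  assumes "DIM('a) = 2 \<or> DIM('a) = 3"
    and "\<forall>i. T0 i \<in> sphere ctr 1"
    and "\<exists>i j. T0 i \<noteq> T0 j"
    and "T1 = second_quad ctr T0"
  shows
    "dist ctr (centroid T1) \<le> dist ctr (centroid T0)
     \<and> (\<forall>(i, j, k, l) \<in> {(1, 2, 3, 4), (1, 3, 2, 4), (1, 4, 2, 3)}.
          sqd T0 i j * sqd T0 k l \<le> sqd T1 i j * sqd T1 k l)
     \<and> Pt T0 \<le> Pt T1
     \<and> (dist ctr (centroid T1) = dist ctr (centroid T0)
          \<longleftrightarrow> opposite_edges_eq T0 \<or> three_coincide T0)
     \<and> (\<forall>(i, j, k, l) \<in> {(1, 2, 3, 4), (1, 3, 2, 4), (1, 4, 2, 3)}.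
          sqd T0 i j * sqd T0 k l = sqd T1 i j * sqd T1 k l
          \<longleftrightarrow> opposite_edges_eq T0 \<or> T0 i = T0 j \<or> T0 k = T0 l)
     \<and> (Pt T0 = Pt T1 \<longleftrightarrow> opposite_edges_eq T0 \<or> Pt T0 = 0)"
proof -
  interpret Q: spherical_quad ctr T0
    using assms by unfold_locales auto
  have products: "\<forall>(i, j, k, l) \<in> {(1, 2, 3, 4), (1, 3, 2, 4), (1, 4, 2, 3)}.
      sqd T1 i j * sqd T1 k l = Q.ratio * (sqd T0 i j * sqd T0 k l)"
    by (simp add: assms(4) Q.opposite_product_second_quad)
  have le: "x \<le> Q.ratio * x" if "x \<ge> 0" for x
    using mult_right_mono[OF Q.ratio_ge_1 that] by simp
  have eq_iff: "x = Q.ratio * x \<longleftrightarrow> opposite_edges_eq T0 \<or> x = 0" for x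
    using Q.ratio_eq_1_iff by auto
  have sqd_nonneg: "sqd T0 i j * sqd T0 k l \<ge> 0" for i j k l
    by (simp add: sqd_def)
  have sqd_zero: "sqd T0 i j * sqd T0 k l = 0 \<longleftrightarrow> T0 i = T0 j \<or> T0 k = T0 l" for i j k l
    by (simp add: sqd_def)
  have ratio_sq: "Q.ratio\<^sup>2 \<ge> 1" "Q.ratio\<^sup>2 = 1 \<longleftrightarrow> Q.ratio = 1"
    using Q.ratio_ge_1 by (auto simp: power2_eq_1_iff)
  have Pt1: "Pt T1 = Q.ratio\<^sup>2 * Pt T0"
    by (simp add: assms(4) Q.Pt_second_quad)
  show ?thesis
  proof (intro conjI)
    show "dist ctr (centroid T1) \<le> dist ctr (centroid T0)"
      using Q.dist_centroid_second_quad_le by (simp add: assms(4))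
    show "\<forall>(i, j, k, l) \<in> {(1, 2, 3, 4), (1, 3, 2, 4), (1, 4, 2, 3)}.
        sqd T0 i j * sqd T0 k l \<le> sqd T1 i j * sqd T1 k l"
      using products by (auto simp: le sqd_nonneg)
    show "Pt T0 \<le> Pt T1"
      using mult_right_mono[OF ratio_sq(1) Pt_nonneg[of T0]] by (simp add: Pt1)
    show "dist ctr (centroid T1) = dist ctr (centroid T0)
        \<longleftrightarrow> opposite_edges_eq T0 \<or> three_coincide T0"
      using Q.dist_centroid_second_quad_eq_iff by (simp add: assms(4))
    show "\<forall>(i, j, k, l) \<in> {(1, 2, 3, 4), (1, 3, 2, 4), (1, 4, 2, 3)}.
        sqd T0 i j * sqd T0 k l = sqd T1 i j * sqd T1 k l
        \<longleftrightarrow> opposite_edges_eq T0 \<or> T0 i = T0 j \<or> T0 k = T0 l"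
      using products eq_iff sqd_zero by auto
    show "Pt T0 = Pt T1 \<longleftrightarrow> opposite_edges_eq T0 \<or> Pt T0 = 0"
      using ratio_sq(2) Q.ratio_eq_1_iff by (auto simp: Pt1)
  qed
qed

end
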